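(* Let $\mathcal{G}=\{\mathcal{V},\mathcal{E}\}$ be an undirected graph on $n$ nodes with a set of grounded nodes $S\subset\mathcal{V}$ (nonempty and proper). Let $\lambda$ denote the smallest eigenvalue of the grounded Laplacian $L_g=L_g(S)$ and let $\mathbf{x}$ be a corresponding (elementwise) nonnegative eigenvector, normalized so that its largest component is $x_{max}=1$. Then $$\frac{|\partial S|}{n-|S|}\,x_{min}\;\le\;\lambda\;\le\;\min_{\emptyset\neq X\subseteq\mathcal{V}\setminus S}\frac{|\partial X|}{|X|}\;\le\;\frac{|\partial S|}{n-|S|},$$ where $x_{min}$ is the smallest component of $\mathbf{x}$.
   Context: Graphs are finite, simple and undirected. The Laplacian matrix of $\mathcal{G}$ is $L=D-A$, where $A\in\{0,1\}^{n\times n}$ is the adjacency matrix and $D$ is the diagonal matrix of node degrees. For a set $S\subset\mathcal{V}$ of "grounded nodes", the grounded Laplacian $L_g(S)$ is the $(n-|S|)\times(n-|S|)$ matrix obtained from $L$ by removing the rows and columns corresponding to the nodes in $S$. For any set $Y\subseteq\mathcal{V}$, the edge-boundary $\partial Y$ is the set of edges of $\mathcal{G}$ with one endpoint in $Y$ and the other in $\mathcal{V}\setminus Y$, each such edge counted once (in particular, for $X\subseteq\mathcal{V}\setminus S$, edges from $X$ to $S$ are included in $\partial X$). *)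

theory Defs
  imports
    "Jordan_Normal_Form.Spectral_Radius"
    "Jordan_Normal_Form.DL_Submatrix"
begin

text \<open>
  Graphs have vertex set \<open>{0..<n}\<close>, so that the vertices directly index the rows and columns of
  the Laplacian. An undirected edge is a two-element set of vertices.
\<close>

definition simple_graph :: "nat \<Rightarrow> nat set set \<Rightarrow> bool" where
  "simple_graph n E \<longleftrightarrow> (\<forall>e\<in>E. e \<subseteq> {0..<n} \<and> card e = 2)"

definition vertex_degree :: "nat set set \<Rightarrow> nat \<Rightarrow> nat" where
  "vertex_degree E v = card {e \<in> E. v \<in> e}"

definition adjacency_matrix :: "nat \<Rightarrow> nat set set \<Rightarrow> real mat" where
  "adjacency_matrix n E = mat n n (\<lambda>(i, j). if {i, j} \<in> E then 1 else 0)"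

definition degree_matrix :: "nat \<Rightarrow> nat set set \<Rightarrow> real mat" where
  "degree_matrix n E = mat n n (\<lambda>(i, j). if i = j then real (vertex_degree E i) else 0)"

definition laplacian :: "nat \<Rightarrow> nat set set \<Rightarrow> real mat" where
  "laplacian n E = degree_matrix n E - adjacency_matrix n E"

text \<open>
  \<open>submatrix A I J\<close> keeps the rows in \<open>I\<close> and the columns in \<open>J\<close>, in increasing order.
\<close>

definition grounded_laplacian :: "nat \<Rightarrow> nat set set \<Rightarrow> nat set \<Rightarrow> real mat" where
  "grounded_laplacian n E S = submatrix (laplacian n E) ({0..<n} - S) ({0..<n} - S)"

definition edge_boundary :: "nat \<Rightarrow> nat set set \<Rightarrow> nat set \<Rightarrow> nat set set" where
  "edge_boundary n E Y = {e \<in> E. \<exists>u\<in>Y. \<exists>v\<in>{0..<n} - Y. e = {u, v}}"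

text \<open>
  The grounded Laplacian is real symmetric, so its eigenvalues are all real and \<open>spectrum\<close> over the
  reals loses none of them. The spectrum is finite, and nonempty for a matrix of positive dimension.
\<close>

definition smallest_eigenvalue :: "real mat \<Rightarrow> real" where
  "smallest_eigenvalue A = Min (spectrum A)"

end

theory Submission
  imports Defs "HOL-Analysis.Function_Topology"
begin

text \<open>
  Write \<open>W\<close> for the complement of \<open>S\<close> and \<open>L\<^sub>g\<close> for the grounded Laplacian. Everything rests on
  one count: for \<open>u \<in> X\<close>, the part of row \<open>u\<close> of the Laplacian with columns in \<open>X\<close> sums to the
  number of edges from \<open>u\<close> to the outside of \<open>X\<close>, because the edges inside \<open>X\<close> cancel against the
  degree (\<open>laplacian_partial_row_sum\<close>). Summing over \<open>u \<in> X\<close> gives \<open>|\<partial>X|\<close>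
  (\<open>sum_crossing_degree\<close>).

  For the upper bounds, the indicator vector of \<open>X \<subseteq> W\<close> therefore has Rayleigh quotient
  \<open>|\<partial>X| / |X|\<close>, and the smallest eigenvalue of a symmetric matrix is at most any Rayleigh quotient
  (\<open>smallest_eigenvalue_le_rayleigh\<close>). Taking \<open>X = W\<close> gives the last inequality, since
  \<open>\<partial>W = \<partial>S\<close>.

  For the lower bound, sum the entries of \<open>L\<^sub>g x = \<lambda> x\<close>. By symmetry the left side is
  \<open>\<Sum>\<^sub>j b\<^sub>j x\<^sub>j\<close>, where \<open>b\<^sub>j\<close> is the number of edges from \<open>j\<close> to \<open>S\<close>; it is at least
  \<open>x\<^sub>m\<^sub>i\<^sub>n |\<partial>S|\<close>, and it is nonnegative, so that \<open>\<lambda> \<ge> 0\<close>. The right side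
  \<open>\<lambda> \<Sum>\<^sub>j x\<^sub>j\<close> is then at most \<open>\<lambda> |W|\<close>, as all entries of \<open>x\<close> are at most 1.
\<close>

section \<open>The Rayleigh principle for real symmetric matrices\<close>

text \<open>
  The type of vectors carries no topology, so the unit sphere of dimension \<open>m\<close> is realised among the functions \<open>nat \<Rightarrow> real\<close> that vanish from \<open>m\<close> on. There it is a closed part of a product
  of compact intervals, hence compact by Tychonoff's theorem.
\<close>

lemma compact_unit_sphere_fun:
  "compact {f :: nat \<Rightarrow> real. (\<forall>i\<ge>m. f i = 0) \<and> (\<Sum>i\<in>{0..<m}. f i * f i) = 1}"
proof -
  define B :: "nat \<Rightarrow> real set" where "B = (\<lambda>i. if i < m then {-1..1} else {0})"
  have "compactin (product_topology (\<lambda>i. euclidean) UNIV) (PiE UNIV B)"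
    by (simp add: compactin_PiE B_def)
  then have box: "compact (PiE UNIV B)"
    by (simp add: euclidean_product_topology)
  have "closed {f :: nat \<Rightarrow> real. (\<Sum>i\<in>{0..<m}. f i * f i) = 1}"
    by (intro closed_Collect_eq continuous_intros continuous_on_product_coordinates)
  with box have "compact (PiE UNIV B \<inter> {f. (\<Sum>i\<in>{0..<m}. f i * f i) = 1})"
    by (rule compact_Int_closed)
  moreover have "PiE UNIV B \<inter> {f. (\<Sum>i\<in>{0..<m}. f i * f i) = 1} =
      {f. (\<forall>i\<ge>m. f i = 0) \<and> (\<Sum>i\<in>{0..<m}. f i * f i) = 1}"
  proof (intro Set.set_eqI iffI)
    fix f assume "f \<in> {f :: nat \<Rightarrow> real. (\<forall>i\<ge>m. f i = 0) \<and> (\<Sum>i\<in>{0..<m}. f i * f i) = 1}"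
    then have f: "\<And>i. i \<ge> m \<Longrightarrow> f i = 0" "(\<Sum>i\<in>{0..<m}. f i * f i) = 1" by auto
    have "f i \<in> {-1..1}" if "i < m" for i
    proof -
      have "f i * f i \<le> (\<Sum>i\<in>{0..<m}. f i * f i)"
        using that by (intro member_le_sum) auto
      then have "\<bar>f i\<bar> \<le> 1" 
        using abs_square_le_1[of "f i"] by (simp add: f(2) power2_eq_square)
      then show ?thesis by auto
    qed
    then show "f \<in> PiE UNIV B \<inter> {f. (\<Sum>i\<in>{0..<m}. f i * f i) = 1}"
      using f by (auto simp: B_def)
  next
    fix f assume f: "f \<in> PiE UNIV B \<inter> {f. (\<Sum>i\<in>{0..<m}. f i * f i) = 1}"
    then have "f i \<in> B i" for i by auto
    then have "f i = 0" if "i \<ge> m" for i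
      using that by (metis B_def not_less singletonD)
    with f show "f \<in> {f. (\<forall>i\<ge>m. f i = 0) \<and> (\<Sum>i\<in>{0..<m}. f i * f i) = 1}" by simp
  qed
  ultimately show ?thesis by simp
qed

text \<open>
  The quadratic form is continuous, so it has a minimum on the compact unit sphere; homogeneity
  of degree 2 carries the inequality over to vectors of any length. The minimum is written without
  division so that it also covers \<open>w = 0\<close>.
\<close>

lemma rayleigh_quotient_attains_min:
  fixes A :: "real mat"
  assumes A: "A \<in> carrier_mat m m" and m: "m > 0"
  obtains g where "g \<in> carrier_vec m" "g \<bullet> g = 1"
    "\<And>w. w \<in> carrier_vec m \<Longrightarrow> (g \<bullet> (A *\<^sub>v g)) * (w \<bullet> w) \<le> w \<bullet> (A *\<^sub>v w)"
proof -
  define K where "K = {f :: nat \<Rightarrow> real. (\<forall>i\<ge>m. f i = 0) \<and> (\<Sum>i\<in>{0..<m}. f i * f i) = 1}"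
  define Q where "Q f = (\<Sum>i\<in>{0..<m}. f i * (\<Sum>j\<in>{0..<m}. A $$ (i, j) * f j))"
    for f :: "nat \<Rightarrow> real"
  have Q: "w \<bullet> (A *\<^sub>v w) = Q (\<lambda>i. w $ i)" if "w \<in> carrier_vec m" for w
    using that A by (simp add: Q_def scalar_prod_def)
  have "(\<lambda>i. if i = 0 then 1 else 0) \<in> K"
    using m by (auto simp: K_def if_distrib sum.delta cong: if_cong)
  moreover have "continuous_on K Q"
    unfolding Q_def by (intro continuous_intros continuous_on_product_coordinates
        continuous_on_subset[OF continuous_on_product_coordinates]) auto
  moreover have "compact K" unfolding K_def by (rule compact_unit_sphere_fun)
  ultimately obtain f where f: "f \<in> K" "\<And>h. h \<in> K \<Longrightarrow> Q f \<le> Q h"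
    using continuous_attains_inf[of K Q] by blast
  define g where "g = vec m f"
  have g: "g \<in> carrier_vec m" and gg: "g \<bullet> g = 1"
    using f(1) by (auto simp: g_def scalar_prod_def K_def)
  have Qg: "g \<bullet> (A *\<^sub>v g) = Q f"
    unfolding Q[OF g] by (simp add: Q_def g_def)
  have "(g \<bullet> (A *\<^sub>v g)) * (w \<bullet> w) \<le> w \<bullet> (A *\<^sub>v w)" if w: "w \<in> carrier_vec m" for w
  proof (cases "w \<bullet> w = 0")
    case True
    have "(\<Sum>i\<in>{0..<m}. w $ i * w $ i) = 0"
      using True w by (simp add: scalar_prod_def)
    then have "\<forall>i\<in>{0..<m}. w $ i = 0"
      by (subst (asm) sum_nonneg_eq_0_iff) auto
    then have "w \<bullet> (A *\<^sub>v w) = 0" unfolding Q[OF w] Q_def by simp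
    with True show ?thesis by simp
  next
    case False
    define s where "s = sqrt (w \<bullet> w)"
    have "w \<bullet> w \<ge> 0" by (auto simp: scalar_prod_def intro!: sum_nonneg)
    with False have s: "s > 0" "s * s = w \<bullet> w" by (auto simp: s_def)
    define h where "h i = (if i < m then w $ i / s else 0)" for i
    have "(\<Sum>i\<in>{0..<m}. h i * h i) = (\<Sum>i\<in>{0..<m}. w $ i * w $ i) / (s * s)"
      unfolding sum_divide_distrib by (simp add: h_def)
    also have "\<dots> = 1" using s w False by (simp add: scalar_prod_def)
    finally have "h \<in> K" by (simp add: K_def h_def)
    then have "Q f \<le> Q h" by (rule f)
    also have "Q h = (w \<bullet> (A *\<^sub>v w)) / (s * s)"
      unfolding Q[OF w] Q_def sum_divide_distrib
      by (simp add: h_def sum_divide_distrib[symmetric])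
    finally have "Q f * (s * s) \<le> w \<bullet> (A *\<^sub>v w)"
      using s(1) by (simp add: pos_le_divide_eq)
    then show ?thesis by (simp add: Qg s(2))
  qed
  with g gg show ?thesis by (rule that)
qed

lemma linear_coeff_zero_if_quadratic_nonneg:
  fixes b c :: real
  assumes "\<And>t. 0 \<le> 2 * t * b + t * t * c"
  shows "b = 0"
proof (rule ccontr)
  assume b: "b \<noteq> 0"
  \<comment> \<open>With \<open>t = - b / d\<close> the linear term dominates as soon as \<open>d > 0\<close> and \<open>2 * d > c\<close>.\<close>
  define d where "d = \<bar>c\<bar> + 1"
  have d: "d > 0" "c < 2 * d" by (auto simp: d_def)
  have "0 \<le> 2 * (- b / d) * b + (- b / d) * (- b / d) * c" by (rule assms)
  also have "\<dots> = (b * b) / (d * d) * (c - 2 * d)"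
    using d by (simp add: field_simps)
  also have "\<dots> < 0" using b d by (intro mult_pos_neg divide_pos_pos) (auto simp: zero_less_mult_iff)
  finally show False by simp
qed

text \<open>
  First-order optimality: let \<open>r = A g - \<mu> g\<close> be the residual at the minimiser \<open>g\<close>. The form
  \<open>w \<bullet> A w - \<mu> (w \<bullet> w)\<close> is nonnegative and vanishes at \<open>g\<close>; along the line \<open>g + t r\<close> it equals
  \<open>2 t (r \<bullet> r)\<close> plus a multiple of \<open>t\<^sup>2\<close>, which forces \<open>r \<bullet> r = 0\<close>.
\<close>

lemma rayleigh_minimizer_is_eigenvector:
  fixes A :: "real mat"
  assumes A: "A \<in> carrier_mat m m" and sym: "transpose_mat A = A"
    and g: "g \<in> carrier_vec m" "g \<bullet> g = 1"
    and min: "\<And>w. w \<in> carrier_vec m \<Longrightarrow> (g \<bullet> (A *\<^sub>v g)) * (w \<bullet> w) \<le> w \<bullet> (A *\<^sub>v w)"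
  shows "eigenvector A g (g \<bullet> (A *\<^sub>v g))"
proof -
  define \<mu> where "\<mu> = g \<bullet> (A *\<^sub>v g)"
  define r where "r = A *\<^sub>v g - \<mu> \<cdot>\<^sub>v g"
  have r: "r \<in> carrier_vec m" using A g by (auto simp: r_def)
  have Ag: "A *\<^sub>v g \<in> carrier_vec m" and Ar: "A *\<^sub>v r \<in> carrier_vec m" using A g r by auto
  have swap: "g \<bullet> (A *\<^sub>v r) = r \<bullet> (A *\<^sub>v g)"
    using transpose_vec_mult_scalar[OF A r g(1)] comm_scalar_prod[OF Ag r] sym by simp
  \<comment> \<open>The linear coefficient of the form along \<open>g + t r\<close> is \<open>2 * (r \<bullet> A g - \<mu> * (r \<bullet> g))\<close>,
    which is \<open>2 * (r \<bullet> r)\<close>.\<close>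
  have gr: "g \<bullet> r = r \<bullet> g" using g r by (simp add: comm_scalar_prod[of _ m])
  have "r \<bullet> r = r \<bullet> (A *\<^sub>v g) - r \<bullet> (\<mu> \<cdot>\<^sub>v g)"
    by (subst (2) r_def) (use r Ag g in \<open>simp add: scalar_prod_minus_distrib[of _ m]\<close>)
  then have rr: "r \<bullet> r = r \<bullet> (A *\<^sub>v g) - \<mu> * (r \<bullet> g)"
    using r g by simp
  have "0 \<le> 2 * t * (r \<bullet> r) + t * t * (r \<bullet> (A *\<^sub>v r) - \<mu> * (r \<bullet> r))" for t
  proof -
    define w where "w = g + t \<cdot>\<^sub>v r"
    have w: "w \<in> carrier_vec m" using g r by (simp add: w_def)
    have Aw: "A *\<^sub>v w = A *\<^sub>v g + t \<cdot>\<^sub>v (A *\<^sub>v r)"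
      using A g r by (simp add: w_def mult_add_distrib_mat_vec mult_mat_vec)
    have "w \<bullet> (A *\<^sub>v w) = \<mu> + t * (g \<bullet> (A *\<^sub>v r)) + (t * (r \<bullet> (A *\<^sub>v g)) + t * t * (r \<bullet> (A *\<^sub>v r)))"
      unfolding Aw unfolding w_def \<mu>_def using g r Ag Ar
      by (simp add: add_scalar_prod_distrib[of _ m] scalar_prod_add_distrib[of _ m] algebra_simps)
    moreover have "w \<bullet> w = 1 + 2 * t * (r \<bullet> g) + t * t * (r \<bullet> r)"
      unfolding w_def using g r gr
      by (simp add: add_scalar_prod_distrib[of _ m] scalar_prod_add_distrib[of _ m] algebra_simps)
    moreover have "\<mu> * (w \<bullet> w) \<le> w \<bullet> (A *\<^sub>v w)" unfolding \<mu>_def by (rule min[OF w])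
    ultimately have "\<mu> * (1 + 2 * t * (r \<bullet> g) + t * t * (r \<bullet> r))
        \<le> \<mu> + 2 * t * (r \<bullet> (A *\<^sub>v g)) + t * t * (r \<bullet> (A *\<^sub>v r))"
      by (simp add: swap algebra_simps)
    moreover have "r \<bullet> (A *\<^sub>v g) = r \<bullet> r + \<mu> * (r \<bullet> g)" using rr by simp
    ultimately show ?thesis by (simp add: algebra_simps)
  qed
  then have "r \<bullet> r = 0" by (rule linear_coeff_zero_if_quadratic_nonneg)
  then have "(\<Sum>i\<in>{0..<m}. r $ i * r $ i) = 0" using r by (simp add: scalar_prod_def)
  then have r0: "\<forall>i\<in>{0..<m}. r $ i = 0"
    by (subst (asm) sum_nonneg_eq_0_iff) auto
  have "A *\<^sub>v g = \<mu> \<cdot>\<^sub>v g"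
  proof (rule eq_vecI)
    fix i assume "i < dim_vec (\<mu> \<cdot>\<^sub>v g)"
    then have i: "i < m" using g by simp
    then have "r $ i = 0" using r0 by simp
    then show "(A *\<^sub>v g) $ i = (\<mu> \<cdot>\<^sub>v g) $ i"
      using i A g Ag by (simp add: r_def)
  qed (use A g in auto)
  moreover have "g \<noteq> 0\<^sub>v m" using g by auto
  ultimately show ?thesis using A g by (simp add: eigenvector_def \<mu>_def)
qed

text \<open>
  The minimum of the Rayleigh quotient is itself an eigenvalue, so the smallest eigenvalue cannot
  exceed it.
\<close>

lemma smallest_eigenvalue_le_rayleigh:
  fixes A :: "real mat"
  assumes A: "A \<in> carrier_mat m m" and sym: "transpose_mat A = A"
    and w: "w \<in> carrier_vec m"
  shows "smallest_eigenvalue A * (w \<bullet> w) \<le> w \<bullet> (A *\<^sub>v w)"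
proof (cases "m = 0")
  case True
  then show ?thesis using A w by (simp add: scalar_prod_def)
next
  case False
  then obtain g where g: "g \<in> carrier_vec m" "g \<bullet> g = 1"
    and min: "\<And>w. w \<in> carrier_vec m \<Longrightarrow> (g \<bullet> (A *\<^sub>v g)) * (w \<bullet> w) \<le> w \<bullet> (A *\<^sub>v w)"
    using rayleigh_quotient_attains_min[OF A] by blast
  have "g \<bullet> (A *\<^sub>v g) \<in> spectrum A"
    using rayleigh_minimizer_is_eigenvector[OF A sym g min]
    by (auto simp: spectrum_def eigenvalue_def)
  then have "smallest_eigenvalue A \<le> g \<bullet> (A *\<^sub>v g)"
    unfolding smallest_eigenvalue_def using card_finite_spectrum[OF A] by simp
  moreover have "0 \<le> w \<bullet> w" by (auto simp: scalar_prod_def intro!: sum_nonneg)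
  ultimately have "smallest_eigenvalue A * (w \<bullet> w) \<le> (g \<bullet> (A *\<^sub>v g)) * (w \<bullet> w)"
    by (rule mult_right_mono)
  also have "\<dots> \<le> w \<bullet> (A *\<^sub>v w)" by (rule min[OF w])
  finally show ?thesis .
qed

section \<open>Laplacian row sums and edge boundaries\<close>

lemma edge_boundary_complement:
  assumes "S \<subseteq> {0..<n}"
  shows "edge_boundary n E ({0..<n} - S) = edge_boundary n E S"
proof -
  have "{0..<n} - ({0..<n} - S) = S" using assms by auto
  then show ?thesis by (auto simp: edge_boundary_def insert_commute)
qed

definition crossing_degree :: "nat \<Rightarrow> nat set set \<Rightarrow> nat set \<Rightarrow> nat \<Rightarrow> nat" where
  "crossing_degree n E X u = card {w \<in> {0..<n} - X. {u, w} \<in> E}"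

lemma vertex_degree_eq_card_neighbours:
  assumes "simple_graph n E"
  shows "vertex_degree E u = card {w \<in> {0..<n}. {u, w} \<in> E}"
proof -
  have "bij_betw (\<lambda>w. {u, w}) {w \<in> {0..<n}. {u, w} \<in> E} {e \<in> E. u \<in> e}"
    unfolding bij_betw_def
  proof
    show "inj_on (\<lambda>w. {u, w}) {w \<in> {0..<n}. {u, w} \<in> E}"
      by (auto simp: inj_on_def doubleton_eq_iff)
    show "(\<lambda>w. {u, w}) ` {w \<in> {0..<n}. {u, w} \<in> E} = {e \<in> E. u \<in> e}"
    proof (intro Set.set_eqI iffI)
      fix e assume "e \<in> {e \<in> E. u \<in> e}"
      then have e: "e \<in> E" "u \<in> e" "e \<subseteq> {0..<n}" "card e = 2"
        using assms by (auto simp: simple_graph_def)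
      then obtain w where "e = {u, w}"
        unfolding card_2_iff by (auto simp: insert_commute)
      then show "e \<in> (\<lambda>w. {u, w}) ` {w \<in> {0..<n}. {u, w} \<in> E}" using e by auto
    qed auto
  qed
  then show ?thesis unfolding vertex_degree_def by (simp add: bij_betw_same_card)
qed

lemma laplacian_carrier: "laplacian n E \<in> carrier_mat n n"
  by (simp add: laplacian_def degree_matrix_def adjacency_matrix_def minus_carrier_mat)

text \<open>
  The diagonal entry counts all neighbours of \<open>u\<close>, and the off-diagonal entries subtract those
  that lie in \<open>X\<close>.
\<close>

lemma laplacian_partial_row_sum:
  assumes G: "simple_graph n E" and X: "X \<subseteq> {0..<n}" and u: "u \<in> X"
  shows "(\<Sum>w\<in>X. laplacian n E $$ (u, w)) = real (crossing_degree n E X u)"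
proof -
  have fin: "finite X" using X finite_subset by blast
  have "(\<Sum>w\<in>X. laplacian n E $$ (u, w)) =
      (\<Sum>w\<in>X. (if u = w then real (vertex_degree E u) else 0) - (if {u, w} \<in> E then 1 else 0))"
  proof (rule sum.cong[OF refl])
    fix w assume "w \<in> X"
    then have "u < n" "w < n" using X u by auto
    then show "laplacian n E $$ (u, w) =
        (if u = w then real (vertex_degree E u) else 0) - (if {u, w} \<in> E then 1 else 0)"
      by (simp add: laplacian_def degree_matrix_def adjacency_matrix_def)
  qed
  also have "\<dots> = real (vertex_degree E u) - real (card {w \<in> X. {u, w} \<in> E})"
    using fin u by (simp add: sum_subtractf sum.delta' sum.inter_filter[symmetric])
  also have "vertex_degree E u =
      card ({w \<in> X. {u, w} \<in> E} \<union> {w \<in> {0..<n} - X. {u, w} \<in> E})"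
    unfolding vertex_degree_eq_card_neighbours[OF G]
    by (rule arg_cong[where f = card]) (use X in auto)
  also have "\<dots> = card {w \<in> X. {u, w} \<in> E} + crossing_degree n E X u"
    unfolding crossing_degree_def using fin by (intro card_Un_disjoint) auto
  finally show ?thesis by simp
qed

text \<open>
  An edge of the boundary has exactly one endpoint in \<open>X\<close>, so it arises from exactly one ordered
  pair \<open>(u, w)\<close> with \<open>u \<in> X\<close> and \<open>w \<notin> X\<close>.
\<close>

lemma sum_crossing_degree:
  assumes X: "X \<subseteq> {0..<n}"
  shows "(\<Sum>u\<in>X. crossing_degree n E X u) = card (edge_boundary n E X)"
proof -
  define P where "P = (SIGMA u:X. {w \<in> {0..<n} - X. {u, w} \<in> E})"
  have "bij_betw (\<lambda>(u, w). {u, w}) P (edge_boundary n E X)"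
    unfolding bij_betw_def
  proof
    show "inj_on (\<lambda>(u, w). {u, w}) P"
      by (auto simp: inj_on_def P_def doubleton_eq_iff)
    show "(\<lambda>(u, w). {u, w}) ` P = edge_boundary n E X"
    proof (intro equalityI subsetI)
      fix e assume "e \<in> edge_boundary n E X"
      then obtain u w where "u \<in> X" "w \<in> {0..<n} - X" "e = {u, w}" "e \<in> E"
        by (auto simp: edge_boundary_def)
      then show "e \<in> (\<lambda>(u, w). {u, w}) ` P" by (auto simp: P_def intro!: image_eqI[of _ _ "(u, w)"])
    next
      fix e assume "e \<in> (\<lambda>(u, w). {u, w}) ` P"
      then obtain u w where "u \<in> X" "w \<in> {0..<n} - X" "e = {u, w}" "e \<in> E"
        by (auto simp: P_def)
      then show "e \<in> edge_boundary n E X" unfolding edge_boundary_def by blast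
    qed
  qed
  then have "card (edge_boundary n E X) = card P" by (simp add: bij_betw_same_card)
  also have "\<dots> = (\<Sum>u\<in>X. crossing_degree n E X u)"
    unfolding P_def crossing_degree_def
    using finite_subset[OF X] by (intro card_SigmaI) auto
  finally show ?thesis by simp
qed

lemma laplacian_symmetric:
  assumes "u < n" "w < n"
  shows "laplacian n E $$ (u, w) = laplacian n E $$ (w, u)"
  using assms
  by (auto simp: laplacian_def degree_matrix_def adjacency_matrix_def insert_commute)

section \<open>The grounded Laplacian\<close>

text \<open>
  \<open>pick W\<close> enumerates \<open>W\<close> in increasing order; it translates between the row and column indices
  of a submatrix and the vertices they stand for.
\<close>

lemma bij_betw_pick:
  assumes "finite W"
  shows "bij_betw (pick W) {0..<card W} W"
proof -
  have "inj_on (pick W) {0..<card W}"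
  proof (rule linorder_inj_onI)
    fix i j assume "i < j" "j \<in> {0..<card W}"
    then have "pick W i < pick W j" by (intro pick_mono_le) auto
    then show "pick W i \<noteq> pick W j" by simp
  qed auto
  moreover have "pick W ` {0..<card W} \<subseteq> W" using pick_in_set_le by auto
  ultimately have "pick W ` {0..<card W} = W"
    using assms by (intro card_subset_eq) (auto simp: card_image)
  with \<open>inj_on (pick W) {0..<card W}\<close> show ?thesis by (simp add: bij_betw_def)
qed

locale grounded_graph =
  fixes n :: nat and E :: "nat set set" and S :: "nat set"
  assumes G: "simple_graph n E"
begin

abbreviation "W \<equiv> {0..<n} - S"
abbreviation "m \<equiv> card W"
abbreviation "p \<equiv> pick W"
abbreviation "Lg \<equiv> grounded_laplacian n E S"

lemma bij_p: "bij_betw p {0..<m} W"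
  by (rule bij_betw_pick) simp

lemma p_in: "i < m \<Longrightarrow> p i \<in> W" 
  using bij_p by (auto simp: bij_betw_def)

lemma sum_p: "(\<Sum>i\<in>{0..<m}. f (p i)) = (\<Sum>u\<in>W. f u)"
  by (rule sum.reindex_bij_betw[OF bij_p])

lemma Lg_carrier: "Lg \<in> carrier_mat m m"
proof -
  have "{i. i < n \<and> i \<in> W} = W" by auto
  then show ?thesis
    using laplacian_carrier[of n E]
    unfolding carrier_mat_def grounded_laplacian_def by (simp add: dim_submatrix)
qed

lemma Lg_index: "i < m \<Longrightarrow> j < m \<Longrightarrow> Lg $$ (i, j) = laplacian n E $$ (p i, p j)"
proof -
  have "{i. i < n \<and> i \<in> W} = W" by auto
  moreover assume "i < m" "j < m"
  ultimately show ?thesis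
    using laplacian_carrier[of n E]
    unfolding grounded_laplacian_def by (subst submatrix_index) auto
qed

lemma Lg_symmetric: "transpose_mat Lg = Lg"
  using Lg_carrier p_in
  by (intro eq_matI) (auto simp: Lg_index laplacian_symmetric)

text \<open>
  The test vector is the indicator of \<open>X\<close>, with squared norm \<open>|X|\<close> and quadratic form
  \<open>|\<partial>X|\<close>.
\<close>

lemma smallest_eigenvalue_le_boundary_ratio:
  assumes X: "X \<noteq> {}" "X \<subseteq> W"
  shows "smallest_eigenvalue Lg \<le> real (card (edge_boundary n E X)) / real (card X)"
proof -
  define h :: "nat \<Rightarrow> real" where "h u = (if u \<in> X then 1 else 0)" for u
  define v where "v = vec m (\<lambda>i. h (p i))"
  have v: "v \<in> carrier_vec m" by (simp add: v_def)
  have h: "(\<Sum>u\<in>W. h u * f u) = (\<Sum>u\<in>X. f u)" for f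
    using X by (intro sum.mono_neutral_cong_right) (auto simp: h_def)
  have "v \<bullet> v = (\<Sum>i\<in>{0..<m}. h (p i) * h (p i))" by (simp add: scalar_prod_def v_def)
  also have "\<dots> = (\<Sum>u\<in>X. h u)" unfolding h[symmetric] by (rule sum_p)
  finally have vv: "v \<bullet> v = real (card X)" by (simp add: h_def)
  have Lv: "(Lg *\<^sub>v v) $ i = (\<Sum>w\<in>X. laplacian n E $$ (p i, w))" if i: "i < m" for i
  proof -
    have "(Lg *\<^sub>v v) $ i = (\<Sum>j\<in>{0..<m}. h (p j) * laplacian n E $$ (p i, p j))"
      using i Lg_carrier by (simp add: scalar_prod_def v_def Lg_index mult.commute)
    also have "\<dots> = (\<Sum>w\<in>X. laplacian n E $$ (p i, w))"
      unfolding h[symmetric] by (rule sum_p)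
    finally show ?thesis .
  qed
  have "v \<bullet> (Lg *\<^sub>v v) = (\<Sum>i\<in>{0..<m}. h (p i) * (\<Sum>w\<in>X. laplacian n E $$ (p i, w)))"
  proof -
    have "dim_vec (Lg *\<^sub>v v) = m" using Lg_carrier by simp
    moreover have "v $ i = h (p i)" if "i < m" for i using that by (simp add: v_def)
    ultimately show ?thesis
      unfolding scalar_prod_def by (intro sum.cong arg_cong2[of _ _ _ _ "(*)"] Lv) simp_all
  qed
  also have "\<dots> = (\<Sum>u\<in>X. \<Sum>w\<in>X. laplacian n E $$ (u, w))"
    unfolding h[symmetric] by (rule sum_p)
  also have "\<dots> = (\<Sum>u\<in>X. real (crossing_degree n E X u))"
    using X by (intro sum.cong refl laplacian_partial_row_sum[OF G]) auto
  also have "\<dots> = real (card (edge_boundary n E X))"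
    using X by (subst sum_crossing_degree[symmetric]) auto
  finally have "smallest_eigenvalue Lg * real (card X) \<le> real (card (edge_boundary n E X))"
    using smallest_eigenvalue_le_rayleigh[OF Lg_carrier Lg_symmetric v] vv by simp
  moreover have "card X > 0" using X finite_subset[of X W] by (simp add: card_gt_0_iff)
  ultimately show ?thesis by (simp add: pos_le_divide_eq)
qed

text \<open>
  Both sides are the entry sum of \<open>L\<^sub>g x\<close>. On the right the order of summation is exchanged and
  symmetry turns column sums of the grounded Laplacian into row sums, which count the edges from a
  vertex to \<open>S\<close>.
\<close>

lemma eigenvalue_times_entry_sum:
  assumes "eigenvector Lg x lam"
  shows "lam * (\<Sum>i\<in>{0..<m}. x $ i) =
    (\<Sum>j\<in>{0..<m}. x $ j * real (crossing_degree n E W (p j)))"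
proof -
  have x: "x \<in> carrier_vec m" and ev: "Lg *\<^sub>v x = lam \<cdot>\<^sub>v x"
    using assms Lg_carrier by (auto simp: eigenvector_def)
  have "lam * (\<Sum>i\<in>{0..<m}. x $ i) = (\<Sum>i\<in>{0..<m}. (Lg *\<^sub>v x) $ i)"
    unfolding ev sum_distrib_left using x by simp
  also have "\<dots> = (\<Sum>i\<in>{0..<m}. \<Sum>j\<in>{0..<m}. x $ j * laplacian n E $$ (p j, p i))"
    using Lg_carrier x p_in
    by (auto intro!: sum.cong simp: scalar_prod_def Lg_index laplacian_symmetric)
  also have "\<dots> = (\<Sum>j\<in>{0..<m}. x $ j * (\<Sum>i\<in>{0..<m}. laplacian n E $$ (p j, p i)))"
    unfolding sum_distrib_left by (rule sum.swap)
  also have "\<dots> = (\<Sum>j\<in>{0..<m}. x $ j * real (crossing_degree n E W (p j)))"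
  proof (intro sum.cong refl arg_cong2[of _ _ _ _ "(*)"])
    fix j assume "j \<in> {0..<m}"
    then have "p j \<in> W" using p_in by simp
    then have "(\<Sum>w\<in>W. laplacian n E $$ (p j, w)) = real (crossing_degree n E W (p j))"
      by (intro laplacian_partial_row_sum[OF G]) auto
    then show "(\<Sum>i\<in>{0..<m}. laplacian n E $$ (p j, p i)) = real (crossing_degree n E W (p j))"
      unfolding sum_p[of "\<lambda>w. laplacian n E $$ (p j, w)"] .
  qed
  finally show ?thesis .
qed

text \<open>
  In the identity for \<open>\<lambda>\<close> times the entry sum, each \<open>x\<^sub>j\<close> on the right is bounded below by the
  smallest entry, and the entry sum on the left is bounded above by \<open>m\<close>. The second step needs
  \<open>\<lambda> \<ge> 0\<close>, which the same identity yields because the entry sum is positive.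
\<close>

lemma boundary_ratio_times_min_entry_le_eigenvalue:
  assumes S: "S \<subseteq> {0..<n}" and ev: "eigenvector Lg x lam"
    and nonneg: "\<And>i. i < m \<Longrightarrow> 0 \<le> x $ i" and max: "Max (set\<^sub>v x) = 1"
  shows "real (card (edge_boundary n E S)) / real m * Min (set\<^sub>v x) \<le> lam"
proof -
  have x: "dim_vec x = m" and x0: "x \<noteq> 0\<^sub>v m"
    using ev Lg_carrier by (auto simp: eigenvector_def)
  have m: "m > 0" using x x0 by (cases "m = 0") auto
  have set: "finite (set\<^sub>v x)" "set\<^sub>v x \<noteq> {}" "\<And>i. i < m \<Longrightarrow> x $ i \<in> set\<^sub>v x"
    using x m by (auto simp: vec_set_def)
  have le1: "x $ i \<le> 1" and ge: "Min (set\<^sub>v x) \<le> x $ i" if "i < m" for i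
    using set max that by (auto simp flip: max)
  obtain k where k: "k < m" "x $ k = 1"
    using Max_in[OF set(1,2)] max x by (auto elim: vec_setE)
  define s where "s = (\<Sum>i\<in>{0..<m}. x $ i)"
  have "x $ k \<le> s" unfolding s_def using k nonneg by (intro member_le_sum) auto
  then have s0: "s > 0" using k by simp
  have sm: "s \<le> real m"
    unfolding s_def using sum_bounded_above[of "{0..<m}" "\<lambda>i. x $ i" 1] le1 by simp
  have eq: "lam * s = (\<Sum>j\<in>{0..<m}. x $ j * real (crossing_degree n E W (p j)))"
    unfolding s_def by (rule eigenvalue_times_entry_sum[OF ev])
  have "0 \<le> lam * s" unfolding eq using nonneg by (intro sum_nonneg) auto
  then have lam0: "0 \<le> lam" using s0 by (simp add: zero_le_mult_iff)
  have "card (edge_boundary n E S) = (\<Sum>u\<in>W. crossing_degree n E W u)"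
    unfolding edge_boundary_complement[OF S, symmetric] by (rule sum_crossing_degree[symmetric]) auto
  also have "\<dots> = (\<Sum>j\<in>{0..<m}. crossing_degree n E W (p j))" by (rule sum_p[symmetric])
  finally have "real (card (edge_boundary n E S)) * Min (set\<^sub>v x) =
      (\<Sum>j\<in>{0..<m}. Min (set\<^sub>v x) * real (crossing_degree n E W (p j)))"
    by (simp add: sum_distrib_left mult.commute)
  also have "\<dots> \<le> lam * s"
    unfolding eq using ge by (intro sum_mono mult_right_mono) auto
  also have "\<dots> \<le> lam * real m" using sm lam0 by (rule mult_left_mono)
  finally show ?thesis using m by (simp add: pos_divide_le_eq)
qed

end

theorem theorem1:
  fixes n :: nat and E :: "nat set set" and S :: "nat set" and lam :: real and x :: "real vec"
  assumes "simple_graph n E"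
    and "S \<noteq> {}" and "S \<subset> {0..<n}"
    and "lam = smallest_eigenvalue (grounded_laplacian n E S)"
    and "eigenvector (grounded_laplacian n E S) x lam"
    and "\<forall>i<dim_vec x. 0 \<le> x $ i"
    and "Max (set\<^sub>v x) = 1"
  shows "real (card (edge_boundary n E S)) / real (n - card S) * Min (set\<^sub>v x) \<le> lam
    \<and> lam \<le> Min ((\<lambda>X. real (card (edge_boundary n E X)) / real (card X))
                   ` {X. X \<noteq> {} \<and> X \<subseteq> {0..<n} - S})
    \<and> Min ((\<lambda>X. real (card (edge_boundary n E X)) / real (card X))
             ` {X. X \<noteq> {} \<and> X \<subseteq> {0..<n} - S})
         \<le> real (card (edge_boundary n E S)) / real (n - card S)"
proof -
  interpret grounded_graph n E S by unfold_locales (rule assms(1))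
  define \<phi> where "\<phi> X = real (card (edge_boundary n E X)) / real (card X)" for X
  define \<X> where "\<X> = {X. X \<noteq> {} \<and> X \<subseteq> {0..<n} - S}"
  have S: "S \<subseteq> {0..<n}" using assms(3) by auto
  have m: "m = n - card S" using S by (simp add: card_Diff_subset finite_subset)
  have W: "W \<in> \<X>" using assms(3) by (auto simp: \<X>_def)
  have "\<X> \<subseteq> Pow W" by (auto simp: \<X>_def)
  then have fin: "finite (\<phi> ` \<X>)" by (simp add: finite_subset)
  have "dim_vec x = m" using assms(5) Lg_carrier by (auto simp: eigenvector_def)
  then have "real (card (edge_boundary n E S)) / real m * Min (set\<^sub>v x) \<le> lam"
    using boundary_ratio_times_min_entry_le_eigenvalue[OF S assms(5)] assms(6,7) by auto
  moreover have "lam \<le> Min (\<phi> ` \<X>)"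
    using fin W smallest_eigenvalue_le_boundary_ratio assms(4)
    by (subst Min_ge_iff) (auto simp: \<phi>_def \<X>_def)
  moreover have "Min (\<phi> ` \<X>) \<le> \<phi> W" using fin W by simp
  ultimately show ?thesis
    unfolding \<phi>_def \<X>_def edge_boundary_complement[OF S] m by simp
qed

end
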